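(* Let $p$ be a prime and let $G = G_p(\alpha,\beta,\epsilon,\delta,+)$ be a metacyclic $p$-group of positive type. Then $\eta(G) = \eta(G/G')$, where $G'$ is the commutator subgroup of $G$.
   Context: For a finite group $G$, a maximal cyclic subgroup is a cyclic subgroup not properly contained in any other cyclic subgroup, and $\eta(G)$ is the number of conjugacy classes of maximal cyclic subgroups of $G$. Write $x^y = y^{-1}xy$. For a prime $p$ and integers $\alpha,\beta>0$, $\delta,\epsilon\ge 0$ with $\delta\le\min\{\alpha-1,\beta\}$, $\delta+\epsilon\le\alpha$, and, if $p=2$, also $\alpha-\delta>1$, the metacyclic group of positive type is $$G_p(\alpha,\beta,\epsilon,\delta,+)=\langle x,y \mid x^{p^\alpha}=1,\ y^{p^\beta}=x^{p^{\alpha-\epsilon}},\ x^y=x^{r}\rangle,\quad r=p^{\alpha-\delta}+1.$$ It has order $p^{\alpha+\beta}$. *)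

theory Defs
  imports "HOL-Algebra.Algebra" "HOL-Computational_Algebra.Primes"
begin

section \<open>Groups given by generators and relations\<close>

text \<open>A letter \<open>(g, True)\<close> stands for the generator \<open>g\<close>, and \<open>(g, False)\<close> for its formal inverse.
  A relation \<open>u = v\<close> is the pair \<open>(u, v)\<close>.\<close>

type_synonym 'g word = "('g \<times> bool) list"

inductive pres_eq :: "('g word \<times> 'g word) set \<Rightarrow> 'g word \<Rightarrow> 'g word \<Rightarrow> bool"
  for R :: "('g word \<times> 'g word) set" where
  rel: "(u, v) \<in> R \<Longrightarrow> pres_eq R u v"
| cancel: "pres_eq R [(g, b), (g, \<not> b)] []"
| refl: "pres_eq R u u"
| sym: "pres_eq R u v \<Longrightarrow> pres_eq R v u"
| trans: "pres_eq R u v \<Longrightarrow> pres_eq R v w \<Longrightarrow> pres_eq R u w"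
| append: "pres_eq R u u' \<Longrightarrow> pres_eq R v v' \<Longrightarrow> pres_eq R (u @ v) (u' @ v')"

definition word_class :: "('g word \<times> 'g word) set \<Rightarrow> 'g word \<Rightarrow> 'g word set" where
  "word_class R u = {v. pres_eq R u v}"

definition presented_group :: "('g word \<times> 'g word) set \<Rightarrow> 'g word set monoid" where
  "presented_group R =
    \<lparr>carrier = range (word_class R),
     monoid.mult = (\<lambda>A B. \<Union>u\<in>A. \<Union>v\<in>B. word_class R (u @ v)),
     one = word_class R []\<rparr>"

lemma word_class_eq_iff: "word_class R u = word_class R v \<longleftrightarrow> pres_eq R u v"
  unfolding word_class_def set_eq_iff mem_Collect_eq
  by (metis pres_eq.refl pres_eq.sym pres_eq.trans)

lemma carrier_presented_group: "carrier (presented_group R) = range (word_class R)"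
  by (simp add: presented_group_def)

lemma one_presented_group: "\<one>\<^bsub>presented_group R\<^esub> = word_class R []"
  by (simp add: presented_group_def)

lemma mult_presented_group:
  "word_class R u \<otimes>\<^bsub>presented_group R\<^esub> word_class R v = word_class R (u @ v)"
proof -
  have "word_class R (u' @ v') = word_class R (u @ v)"
    if "u' \<in> word_class R u" "v' \<in> word_class R v" for u' v'
  proof -
    have "pres_eq R u u'" "pres_eq R v v'" using that by (simp_all add: word_class_def)
    then show ?thesis by (metis word_class_eq_iff pres_eq.append)
  qed
  moreover have "u \<in> word_class R u" "v \<in> word_class R v"
    by (auto simp: word_class_def intro: pres_eq.refl)
  ultimately show ?thesis
    unfolding presented_group_def monoid.simps by (intro equalityI subsetI) blast+
qed

definition word_inv :: "'g word \<Rightarrow> 'g word" where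
  "word_inv w = rev (map (\<lambda>(g, b). (g, \<not> b)) w)"

lemma word_inv_left: "pres_eq R (word_inv w @ w) []"
proof (induction w)
  case Nil
  then show ?case by (simp add: word_inv_def pres_eq.refl)
next
  case (Cons a w)
  obtain g b where a: "a = (g, b)" by force
  have "pres_eq R ([(g, \<not> b), (g, \<not> \<not> b)] @ w) ([] @ w)"
    by (intro pres_eq.append pres_eq.cancel pres_eq.refl)
  then have "pres_eq R (word_inv w @ ([(g, \<not> b), (g, b)] @ w)) (word_inv w @ w)"
    by (intro pres_eq.append pres_eq.refl) simp
  from pres_eq.trans[OF this Cons.IH] show ?case
    by (simp add: a word_inv_def)
qed

lemma group_presented_group: "group (presented_group R)"
proof (rule groupI)
  fix x assume "x \<in> carrier (presented_group R)"
  then obtain u where "x = word_class R u" by (auto simp: carrier_presented_group)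
  then have "word_class R (word_inv u) \<otimes>\<^bsub>presented_group R\<^esub> x = \<one>\<^bsub>presented_group R\<^esub>"
    by (simp add: mult_presented_group one_presented_group word_class_eq_iff word_inv_left)
  then show "\<exists>y\<in>carrier (presented_group R). y \<otimes>\<^bsub>presented_group R\<^esub> x = \<one>\<^bsub>presented_group R\<^esub>"
    by (auto simp: carrier_presented_group)
qed (auto simp: carrier_presented_group mult_presented_group one_presented_group)

text \<open>The defining universal property.\<close>

primrec word_eval :: "('a, 'm) monoid_scheme \<Rightarrow> ('g \<Rightarrow> 'a) \<Rightarrow> 'g word \<Rightarrow> 'a" where
  "word_eval H f [] = \<one>\<^bsub>H\<^esub>"
| "word_eval H f (a # w) = (if snd a then f (fst a) else inv\<^bsub>H\<^esub> f (fst a)) \<otimes>\<^bsub>H\<^esub> word_eval H f w"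

lemma (in group) word_eval_closed:
  "range f \<subseteq> carrier G \<Longrightarrow> word_eval G f w \<in> carrier G"
  by (induction w) auto

lemma (in group) word_eval_append:
  assumes "range f \<subseteq> carrier G"
  shows "word_eval G f (u @ v) = word_eval G f u \<otimes> word_eval G f v"
proof (induction u)
  case Nil
  then show ?case using word_eval_closed[OF assms] by simp
next
  case (Cons a u)
  have "f (fst a) \<in> carrier G" using assms by blast
  then show ?case
    using Cons word_eval_closed[OF assms] by (auto simp: m_assoc)
qed

lemma (in group) word_eval_pres_eq:
  assumes f: "range f \<subseteq> carrier G"
    and R: "\<And>u v. (u, v) \<in> R \<Longrightarrow> word_eval G f u = word_eval G f v"
    and "pres_eq R u v"
  shows "word_eval G f u = word_eval G f v"
  using assms(3)
proof (induction rule: pres_eq.induct)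
  case (cancel g b)
  have "f g \<in> carrier G" using f by blast
  then show ?case by simp
qed (simp_all add: R word_eval_append[OF f])

lemma (in group) presented_group_universal:
  assumes f: "range f \<subseteq> carrier G"
    and R: "\<And>u v. (u, v) \<in> R \<Longrightarrow> word_eval G f u = word_eval G f v"
  shows "\<exists>h\<in>hom (presented_group R) G. \<forall>w. h (word_class R w) = word_eval G f w"
proof -
  define h where "h A = word_eval G f (SOME w. A = word_class R w)" for A
  have h: "h (word_class R w) = word_eval G f w" for w
    unfolding h_def
    by (rule someI2[of _ w]) (auto simp: word_class_eq_iff intro: word_eval_pres_eq[OF f R, symmetric])
  have "h \<in> hom (presented_group R) G"
    by (auto simp: hom_def carrier_presented_group mult_presented_group h
        word_eval_append[OF f] word_eval_closed[OF f])
  then show ?thesis using h by blast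
qed

section \<open>Metacyclic groups of positive type\<close>

datatype xy = Gx | Gy

definition metacyclic_pos :: "nat \<Rightarrow> nat \<Rightarrow> nat \<Rightarrow> nat \<Rightarrow> nat \<Rightarrow> xy word set monoid" where
  "metacyclic_pos p \<alpha> \<beta> \<epsilon> \<delta> = presented_group
    {(replicate (p ^ \<alpha>) (Gx, True), []),
     (replicate (p ^ \<beta>) (Gy, True), replicate (p ^ (\<alpha> - \<epsilon>)) (Gx, True)),
     ([(Gy, False), (Gx, True), (Gy, True)], replicate (p ^ (\<alpha> - \<delta>) + 1) (Gx, True))}"

section \<open>Maximal cyclic subgroups\<close>

definition cyclic_subgroup :: "'a set \<Rightarrow> ('a, 'm) monoid_scheme \<Rightarrow> bool" where
  "cyclic_subgroup H G \<longleftrightarrow> subgroup H G \<and> cyclic_group (G\<lparr>carrier := H\<rparr>)"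

definition maximal_cyclic_subgroup :: "'a set \<Rightarrow> ('a, 'm) monoid_scheme \<Rightarrow> bool" where
  "maximal_cyclic_subgroup H G \<longleftrightarrow> cyclic_subgroup H G \<and> (\<nexists>K. cyclic_subgroup K G \<and> H \<subset> K)"

definition eta :: "('a, 'm) monoid_scheme \<Rightarrow> nat" where
  "eta G = card (orbits G {H. maximal_cyclic_subgroup H G}
                   (\<lambda>g H. g <#\<^bsub>G\<^esub> H #>\<^bsub>G\<^esub> inv\<^bsub>G\<^esub> g))"

lemma (in group) cyclic_subgroup_iff:
  "cyclic_subgroup H G \<longleftrightarrow> (\<exists>g\<in>carrier G. H = generate G {g})"
proof
  assume "cyclic_subgroup H G"
  then have H: "subgroup H G" and "cyclic_group (G\<lparr>carrier := H\<rparr>)"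
    by (auto simp: cyclic_subgroup_def)
  then obtain g where g: "g \<in> H" "subgroup_generated (G\<lparr>carrier := H\<rparr>) {g} = G\<lparr>carrier := H\<rparr>"
    by (auto simp: cyclic_group_def)
  from arg_cong[OF g(2), of carrier] have "generate (G\<lparr>carrier := H\<rparr>) {g} = H"
    using g(1) by (simp add: subgroup_generated_def)
  then have "generate G {g} = H"
    using generate_consistent[of "{g}" H] H g(1) by simp
  then show "\<exists>g\<in>carrier G. H = generate G {g}"
    using g(1) subgroup.subset[OF H] by blast
next
  assume "\<exists>g\<in>carrier G. H = generate G {g}"
  then obtain g where g: "g \<in> carrier G" "H = generate G {g}" by blast
  then have H: "subgroup H G" by (simp add: generate_is_subgroup)
  have gH: "g \<in> H" using g by (simp add: generate.incl)
  have "generate (G\<lparr>carrier := H\<rparr>) {g} = H"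
    using generate_consistent[of "{g}" H] H gH g(2) by simp
  then have "subgroup_generated (G\<lparr>carrier := H\<rparr>) {g} = G\<lparr>carrier := H\<rparr>"
    using gH by (simp add: subgroup_generated_def)
  then show "cyclic_subgroup H G"
    using H gH by (auto simp: cyclic_subgroup_def cyclic_group_def)
qed

end

theory Submission
  imports Defs "HOL-Number_Theory.Cong"
begin

text \<open>
  Put \<open>q = p\<^sup>\<alpha>\<^sup>-\<^sup>\<delta>\<close>, so that \<open>x y = y x\<^sup>1\<^sup>+\<^sup>q\<close>; then \<open>p\<close> divides \<open>q\<close>, and \<open>4\<close> divides \<open>q\<close> if \<open>p = 2\<close>.
  Every element of \<open>G\<close> has the form \<open>y\<^sup>j x\<^sup>i\<close>, and \<open>G'\<close> lies in the subgroup generated by \<open>x\<^sup>q\<close>.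

  In a nontrivial group all of whose elements have \<open>p\<close>-power order, \<open>c\<close> generates a maximal cyclic
  subgroup if and only if \<open>c\<close> is not a \<open>p\<close>-th power
  (\<open>maximal_cyclic_iff_not_prime_power\<close>). The theorem therefore reduces to two facts.

  First, \<open>c\<close> is a \<open>p\<close>-th power in \<open>G\<close> as soon as \<open>c G'\<close> is one in \<open>G/G'\<close>. Indeed
  \<open>(y\<^sup>j x\<^sup>i)\<^sup>p = y\<^sup>p\<^sup>j x\<^sup>i\<^sup>S\<close>, where \<open>S\<close> is a geometric sum of \<open>p\<close> terms with a ratio congruent to \<open>1\<close>
  modulo \<open>q\<close>, and such a sum is \<open>p\<close> times a unit modulo \<open>p\<close>. So the \<open>p\<close>-th powers of \<open>G\<close> are exactly
  the elements \<open>y\<^sup>p\<^sup>j x\<^sup>p\<^sup>i\<close>, a set stable under multiplication by powers of \<open>x\<^sup>q\<close>.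

  Second, if \<open>c = y\<^sup>j x\<^sup>i\<close> is not a \<open>p\<close>-th power, then all elements of \<open>c G'\<close> are conjugate to \<open>c\<close>
  (\<open>conjugate_mult_x\<close>). Here \<open>p\<close> does not divide both exponents. If it does not divide \<open>j\<close>, conjugation
  by powers of \<open>x\<close> already multiplies \<open>c\<close> by every power of \<open>x\<^sup>q\<close>. If it does not divide \<open>i\<close>, conjugation
  by \<open>y\<^sup>l\<close> replaces \<open>x\<^sup>i\<close> by its power of exponent \<open>(1+q)\<^sup>l\<close>, and the powers of \<open>1+q\<close> run through
  all residues modulo \<open>p\<^sup>\<alpha>\<close> that are \<open>1\<close> modulo \<open>q\<close>.

  By the first fact the generators of maximal cyclic subgroups correspond under \<open>G \<rightarrow> G/G'\<close>, and by the
  second no two classes are merged; \<open>eta_eq_of_surj\<close> turns this into the equality of the two numbers.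
\<close>

section \<open>Powers and geometric sums of integers close to 1\<close>

lemma one_plus_power_eq: "(1 + c) ^ n = 1 + c * (\<Sum>k<n. (1 + c) ^ k)" for c :: nat
  by (induction n) (simp_all add: algebra_simps)

lemma one_plus_power_cong: "[(1 + c) ^ n = 1 + n * c] (mod c ^ 2)" for c :: nat
proof (induction n)
  case (Suc n)
  have "[(1 + c) * (1 + c) ^ n = (1 + c) * (1 + n * c)] (mod c ^ 2)"
    using Suc by (rule cong_scalar_left)
  moreover have "(1 + c) * (1 + n * c) = (1 + Suc n * c) + n * c ^ 2"
    by (simp add: algebra_simps power2_eq_square)
  ultimately have "[(1 + c) ^ Suc n = (1 + Suc n * c) + n * c ^ 2] (mod c ^ 2)"
    by (simp only: power_Suc)
  then show ?case
    by (metis cong_add_lcancel_0_nat cong_mult_self_right cong_trans)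
qed simp

text \<open>Expanding each power to first order turns the sum into \<open>p + p b (0 + 1 + \<dots> + (p - 1))\<close> modulo \<open>p\<^sup>2\<close>.
  The triangular number is divisible by \<open>p\<close> for odd \<open>p\<close>; for \<open>p = 2\<close> the factor \<open>b\<close> must supply the
  missing \<open>2\<close>.\<close>

lemma prime_geometric_sum:
  fixes p b :: nat
  assumes p: "Factorial_Ring.prime p" and two: "p = 2 \<Longrightarrow> even b"
  obtains u where "(\<Sum>k<p. (1 + p * b) ^ k) = p * u" "coprime u p"
proof -
  have "p dvd b * (\<Sum>k<p. k)"
  proof (cases "p = 2")
    case False
    then have "odd p" using p prime_odd_nat prime_ge_2_nat[OF p] by force
    moreover have "2 * (\<Sum>k<p. k) = p * (p - 1)"
      using gauss_sum_nat[of "p - 1"] prime_gt_0_nat[OF p]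
      by (cases p) (auto simp: lessThan_Suc_atMost atLeast0AtMost)
    ultimately have "p dvd (\<Sum>k<p. k)"
      by (metis coprime_dvd_mult_right_iff coprime_right_2_iff_odd dvd_triv_left)
    then show ?thesis by simp
  qed (use two in simp)
  then have "p ^ 2 dvd p * (b * (\<Sum>k<p. k))"
    by (simp add: power2_eq_square)
  then have "[p + p * (b * (\<Sum>k<p. k)) = p + 0] (mod p ^ 2)"
    by (intro cong_add) (simp_all add: cong_0_iff)
  moreover have "[(\<Sum>k<p. (1 + p * b) ^ k) = (\<Sum>k<p. 1 + k * (p * b))] (mod p ^ 2)"
    by (intro cong_sum cong_dvd_modulus_nat[OF one_plus_power_cong])
       (simp add: power_mult_distrib)
  moreover have "(\<Sum>k<p. 1 + k * (p * b)) = p + p * (b * (\<Sum>k<p. k))"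
    unfolding sum.distrib by (simp add: sum_distrib_left mult_ac)
  ultimately have S: "[(\<Sum>k<p. (1 + p * b) ^ k) = p * 1] (mod p * p)"
    by (simp add: cong_def power2_eq_square)
  then have "p dvd (\<Sum>k<p. (1 + p * b) ^ k)"
    by (metis cong_dvd_iff cong_dvd_modulus_nat dvd_triv_left)
  then obtain u where u: "(\<Sum>k<p. (1 + p * b) ^ k) = p * u" by blast
  with S have "[u = 1] (mod p)"
    using prime_gt_0_nat[OF p] by (simp add: cong_def mod_mult_mult1)
  then have "coprime u p"
    by (metis cong_imp_coprime cong_sym coprime_1_left)
  with u that show thesis by blast
qed

text \<open>The hypotheses under which \<open>1 + q\<close> behaves like the exponential of \<open>q\<close> over the \<open>p\<close>-adic integers:
  its powers are dense in the congruence subgroup \<open>1 + q \<int>\<^sub>p\<close>. For \<open>p = 2\<close> and \<open>q = 2\<close> this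
  fails, since \<open>3\<^sup>l\<close> is never \<open>5\<close> modulo \<open>8\<close>.\<close>

locale lifting_modulus =
  fixes p q :: nat
  assumes prime_p: "Factorial_Ring.prime p"
    and p_dvd_q: "p dvd q"
    and four_dvd_q: "p = 2 \<Longrightarrow> 4 dvd q"
begin

lemma geometric_sum:
  obtains u where "(\<Sum>k<p. (1 + q * a) ^ k) = p * u" "coprime u p"
proof -
  obtain b where b: "q = p * b" using p_dvd_q by blast
  then have "p = 2 \<Longrightarrow> even (b * a)" using four_dvd_q by auto
  from prime_geometric_sum[OF prime_p this] that show thesis
    by (metis b mult.assoc)
qed

text \<open>For a multiple \<open>z\<close> of \<open>q\<close>, raising \<open>1 + z\<close> to the power \<open>p\<close> multiplies \<open>z\<close> by a geometric sum of
  \<open>p\<close> terms, which contains exactly one factor \<open>p\<close>.\<close>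

lemma power_prime_power:
  obtains u where "(1 + q) ^ (p ^ k) = 1 + q * p ^ k * u" "coprime u p"
proof -
  have "\<exists>u. (1 + q) ^ (p ^ k) = 1 + q * p ^ k * u \<and> coprime u p"
  proof (induction k)
    case 0
    show ?case by (intro exI[of _ 1]) simp
  next
    case (Suc k)
    then obtain u where u: "(1 + q) ^ (p ^ k) = 1 + q * p ^ k * u" "coprime u p" by blast
    obtain w where w: "(\<Sum>l<p. (1 + q * (p ^ k * u)) ^ l) = p * w" "coprime w p"
      by (rule geometric_sum)
    have "(1 + q) ^ (p ^ Suc k) = (1 + q * (p ^ k * u)) ^ p"
      using u(1) by (simp add: power_mult mult.assoc mult.commute[of p])
    also have "\<dots> = 1 + q * p ^ Suc k * (u * w)"
      unfolding one_plus_power_eq[of "q * (p ^ k * u)"] w(1) by (simp add: mult_ac)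
    finally show ?case using u(2) w(2) by auto
  qed
  with that show thesis by blast
qed

text \<open>Hensel-style lifting: multiplying by \<open>(1 + q)\<close> to the power \<open>a p\<^sup>k\<close> leaves the residue modulo
  \<open>q p\<^sup>k\<close> alone and shifts the next \<open>p\<close>-adic digit by a unit multiple of \<open>a\<close>.\<close>

lemma power_surj_mod:
  obtains l where "[(1 + q) ^ l = 1 + q * t] (mod q * p ^ k)"
proof -
  have "\<exists>l. [(1 + q) ^ l = 1 + q * t] (mod q * p ^ k)"
  proof (induction k)
    case 0
    have "[1 + q * t = 1] (mod q)"
      by (simp only: cong_add_lcancel_0_nat cong_mult_self_left)
    then show ?case by (metis cong_sym mult_1_right power_0)
  next
    case (Suc k)
    then obtain l where "[(1 + q) ^ l = 1 + q * t] (mod q * p ^ k)" by blast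
    then have "[int (1 + q * t) = int ((1 + q) ^ l)] (mod int (q * p ^ k))"
      unfolding cong_int_iff by (rule cong_sym)
    then obtain v where v: "int (1 + q * t) = int ((1 + q) ^ l) + int (q * p ^ k) * v"
      by (metis cong_iff_lin cong_sym)
    obtain u where u: "(1 + q) ^ (p ^ k) = 1 + q * p ^ k * u" "coprime u p"
      by (rule power_prime_power)
    \<comment> \<open>The digit to be corrected is \<open>v\<close>, and \<open>a\<close> copies of the correcting factor contribute \<open>u (1 + q)\<^sup>l a\<close>.\<close>
    define w where "w = q * p ^ k * u"
    have "coprime (1 + q) p"
      by (rule coprime_divisors[OF dvd_refl p_dvd_q]) simp
    then have "coprime (int (u * (1 + q) ^ l)) (int p)"
      using u(2) by (simp add: coprime_int_iff del: of_nat_mult of_nat_add of_nat_power)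
    then obtain a0 where a0: "[int (u * (1 + q) ^ l) * a0 = 1] (mod int p)"
      using cong_solve_coprime_int by blast
    define a where "a = nat ((a0 * v) mod int p)"
    have a: "[int a = a0 * v] (mod int p)"
      using prime_gt_0_nat[OF prime_p] by (simp add: a_def cong_def)
    have "[int (u * (1 + q) ^ l) * int a = int (u * (1 + q) ^ l) * (a0 * v)] (mod int p)"
      using a by (rule cong_scalar_left)
    moreover have "[int (u * (1 + q) ^ l) * a0 * v = 1 * v] (mod int p)"
      using a0 by (rule cong_scalar_right)
    ultimately have "[int (u * (1 + q) ^ l) * int a = v] (mod int p)"
      by (metis cong_trans mult.assoc mult_1)
    then have "int p dvd int (u * (1 + q) ^ l) * int a - v"
      by (simp add: cong_iff_dvd_diff)
    then have "int (q * p ^ k) * int p dvd int (q * p ^ k) * (int (u * (1 + q) ^ l) * int a - v)"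
      by (rule mult_dvd_mono[OF dvd_refl])
    moreover have "int (q * p ^ k) * (int (u * (1 + q) ^ l) * int a - v)
        = int ((1 + q) ^ l * (1 + a * w)) - int (1 + q * t)"
      unfolding v w_def by (simp add: algebra_simps)
    moreover have "int (q * p ^ k) * int p = int (q * p ^ Suc k)" by simp
    ultimately have "[(1 + q) ^ l * (1 + a * w) = 1 + q * t] (mod q * p ^ Suc k)"
      by (simp only: cong_int_iff[symmetric] cong_iff_dvd_diff)
    moreover have "[(1 + w) ^ a = 1 + a * w] (mod q * p ^ Suc k)"
    proof (rule cong_dvd_modulus_nat[OF one_plus_power_cong])
      have "p dvd w" unfolding w_def using p_dvd_q by (simp add: dvd_mult2)
      then have "(q * p ^ k) * p dvd w * w" by (intro mult_dvd_mono) (simp_all add: w_def)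
      then show "q * p ^ Suc k dvd w ^ 2" by (simp add: power2_eq_square mult_ac)
    qed
    then have "[(1 + q) ^ l * (1 + w) ^ a = (1 + q) ^ l * (1 + a * w)] (mod q * p ^ Suc k)"
      by (rule cong_scalar_left)
    moreover have "(1 + q) ^ (l + p ^ k * a) = (1 + q) ^ l * (1 + w) ^ a"
      by (simp only: power_add power_mult u(1) w_def)
    ultimately show ?case by (metis cong_trans)
  qed
  with that show thesis by blast
qed

end

lemma prime_coprime_pow_solve:
  fixes p v t n :: nat
  assumes "Factorial_Ring.prime p" "\<not> p dvd v"
  obtains k where "[v * k = t] (mod p ^ n)"
proof -
  have "coprime v (p ^ n)"
    using assms by (metis coprime_commute coprime_power_right_iff prime_imp_coprime)
  then obtain k where "[v * k = 1] (mod p ^ n)" by (metis One_nat_def cong_solve_coprime_nat)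
  then have "[v * k * t = 1 * t] (mod p ^ n)" by (rule cong_scalar_right)
  with that[of "k * t"] show thesis by (simp add: mult.assoc)
qed

section \<open>Counting conjugacy classes of maximal cyclic subgroups\<close>

context group
begin

abbreviation conj_set :: "'a \<Rightarrow> 'a set \<Rightarrow> 'a set" where
  "conj_set g A \<equiv> g <# A #> inv g"

lemma conj_set_eq_image: "conj_set g A = (\<lambda>a. g \<otimes> a \<otimes> inv g) ` A"
  by (auto simp: l_coset_def r_coset_def)

lemma conj_set_mult:
  assumes "g \<in> carrier G" "k \<in> carrier G" "A \<subseteq> carrier G"
  shows "conj_set g (conj_set k A) = conj_set (g \<otimes> k) A"
  unfolding conj_set_eq_image image_image
proof (rule image_cong)
  fix a assume "a \<in> A"
  then have "a \<in> carrier G" using assms(3) by blast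
  then show "g \<otimes> (k \<otimes> a \<otimes> inv k) \<otimes> inv g = g \<otimes> k \<otimes> a \<otimes> inv (g \<otimes> k)"
    using assms(1,2) by (simp add: inv_mult_group m_assoc)
qed simp

lemma conj_set_one: "A \<subseteq> carrier G \<Longrightarrow> conj_set \<one> A = A"
  unfolding conj_set_eq_image by (simp add: subset_iff cong: image_cong_simp)

lemma conj_set_generate:
  assumes "g \<in> carrier G" "c \<in> carrier G"
  shows "conj_set g (generate G {c}) = generate G {g \<otimes> c \<otimes> inv g}"
proof -
  have "inv g \<otimes> (g \<otimes> a) = a" if "a \<in> carrier G" for a
    using that assms(1) by (simp flip: m_assoc)
  then have "(\<lambda>a. g \<otimes> a \<otimes> inv g) \<in> hom G G"
    using assms(1) by (simp add: hom_def m_assoc)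
  then have "group_hom G G (\<lambda>a. g \<otimes> a \<otimes> inv g)"
    by (simp add: group_hom_def group_hom_axioms_def)
  from group_hom.generate_img[OF this, of "{c}"] show ?thesis
    using assms(2) by (simp add: conj_set_eq_image)
qed

lemma orbit_conj_set_eq_iff:
  assumes "A \<subseteq> carrier G" "B \<subseteq> carrier G"
  shows "orbit G conj_set A = orbit G conj_set B \<longleftrightarrow> (\<exists>g\<in>carrier G. B = conj_set g A)"
proof
  assume "orbit G conj_set A = orbit G conj_set B"
  moreover have "B \<in> orbit G conj_set B"
    unfolding orbit_def mem_Collect_eq using conj_set_one[OF assms(2)] by (metis one_closed)
  ultimately have "B \<in> orbit G conj_set A" by simp
  then show "\<exists>g\<in>carrier G. B = conj_set g A" unfolding orbit_def by blast
next
  assume "\<exists>g\<in>carrier G. B = conj_set g A"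
  then obtain g where g: "g \<in> carrier G" "B = conj_set g A" by blast
  have "conj_set k A = conj_set (k \<otimes> inv g) B" if "k \<in> carrier G" for k
    using that g assms by (simp add: conj_set_mult m_assoc)
  moreover have "conj_set k B = conj_set (k \<otimes> g) A" if "k \<in> carrier G" for k
    using that g assms by (simp add: conj_set_mult)
  ultimately show "orbit G conj_set A = orbit G conj_set B"
    unfolding orbit_def using g(1) by (intro equalityI subsetI; clarsimp) (metis inv_closed m_closed)+
qed

text \<open>Classes of subgroups are indexed by generators, because generators can be pushed forward and
  lifted along a homomorphism.\<close>

definition max_cyclic_generators :: "'a set" where
  "max_cyclic_generators = {c \<in> carrier G. maximal_cyclic_subgroup (generate G {c}) G}"

lemma eta_eq_card_image:
  "eta G = card ((\<lambda>c. orbit G conj_set (generate G {c})) ` max_cyclic_generators)"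
proof -
  have "H \<in> (\<lambda>c. generate G {c}) ` max_cyclic_generators" if max: "maximal_cyclic_subgroup H G" for H
  proof -
    have "cyclic_subgroup H G" using max by (simp add: maximal_cyclic_subgroup_def)
    then obtain c where "c \<in> carrier G" "H = generate G {c}"
      using cyclic_subgroup_iff by blast
    then show ?thesis using max by (simp add: max_cyclic_generators_def)
  qed
  then have "{H. maximal_cyclic_subgroup H G} = (\<lambda>c. generate G {c}) ` max_cyclic_generators"
    by (auto simp: max_cyclic_generators_def)
  moreover have "orbits G (f ` M) \<phi> = (\<lambda>c. orbit G \<phi> (f c)) ` M"
    for \<phi> :: "'a \<Rightarrow> 'a set \<Rightarrow> 'a set" and f :: "'a \<Rightarrow> 'a set" and M
    unfolding orbits_def by blast
  ultimately show ?thesis by (simp only: eta_def)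
qed

lemma generate_mono_mem:
  assumes "c \<in> carrier G" "d \<in> generate G {c}" shows "generate G {d} \<subseteq> generate G {c}"
  using assms by (intro generate_subgroup_incl generate_is_subgroup) auto

lemma mem_generate_iff:
  "c \<in> carrier G \<Longrightarrow> d \<in> generate G {c} \<longleftrightarrow> (\<exists>k :: int. d = c [^] k)"
  unfolding generate_pow by blast

end

lemma card_image_eq_of_same_kernel:
  assumes "\<And>a b. a \<in> M \<Longrightarrow> b \<in> M \<Longrightarrow> f a = f b \<longleftrightarrow> g a = g b"
  shows "card (f ` M) = card (g ` M)"
proof (rule bij_betw_same_card)
  let ?F = "\<lambda>y. g (inv_into M f y)"
  have F: "?F (f a) = g a" if "a \<in> M" for a
    using that assms by (metis f_inv_into_f imageI inv_into_into)
  show "bij_betw ?F (f ` M) (g ` M)"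
    unfolding bij_betw_def inj_on_def using F assms by (auto simp: image_image)
qed

text \<open>Under these hypotheses the map from classes to classes is well defined and onto. For injectivity, if
  \<open>h d\<close> generates the image of \<open>\<langle>c\<rangle>\<close>, then \<open>h d = h e\<close> for some \<open>e \<in> \<langle>c\<rangle>\<close>; the element \<open>e\<close>
  generates a maximal cyclic subgroup like \<open>h d\<close>, hence all of \<open>\<langle>c\<rangle>\<close>, and \<open>e\<close> is conjugate to \<open>d\<close>.\<close>

lemma (in group_hom) eta_eq_of_surj:
  assumes surj: "h ` carrier G = carrier H"
    and max: "\<And>c. c \<in> carrier G \<Longrightarrow>
      maximal_cyclic_subgroup (generate G {c}) G \<longleftrightarrow> maximal_cyclic_subgroup (generate H {h c}) H"
    and fibre: "\<And>c d. \<lbrakk>c \<in> carrier G; d \<in> carrier G; maximal_cyclic_subgroup (generate G {c}) G; h c = h d\<rbrakk>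
      \<Longrightarrow> \<exists>g\<in>carrier G. d = g \<otimes> c \<otimes> inv g"
  shows "eta G = eta H"
proof -
  have img: "h ` generate G {c} = generate H {h c}" if "c \<in> carrier G" for c
    using generate_img[of "{c}"] that by simp
  have sub: "generate G {c} \<subseteq> carrier G" if "c \<in> carrier G" for c
    using that by (simp add: G.generate_incl)
  have subH: "generate H {h c} \<subseteq> carrier H" if "c \<in> carrier G" for c
    using that by (simp add: H.generate_incl)
  have gens: "H.max_cyclic_generators = h ` G.max_cyclic_generators"
    unfolding H.max_cyclic_generators_def G.max_cyclic_generators_def surj[symmetric]
    using max by blast
  have "orbit G G.conj_set (generate G {c}) = orbit G G.conj_set (generate G {d}) \<longleftrightarrow>
      orbit H H.conj_set (generate H {h c}) = orbit H H.conj_set (generate H {h d})"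
    (is "?l \<longleftrightarrow> ?r")
    if c: "c \<in> G.max_cyclic_generators" and d: "d \<in> G.max_cyclic_generators" for c d
  proof -
    have cG: "c \<in> carrier G" and dG: "d \<in> carrier G"
      and dmax: "maximal_cyclic_subgroup (generate G {d}) G"
      using c d by (auto simp: G.max_cyclic_generators_def)
    note iff = G.orbit_conj_set_eq_iff[OF sub[OF cG] sub[OF dG]]
      H.orbit_conj_set_eq_iff[OF subH[OF cG] subH[OF dG]]
    show ?thesis
    proof
      assume ?l
      then obtain g where g: "g \<in> carrier G" "generate G {d} = G.conj_set g (generate G {c})"
        unfolding iff(1) by blast
      have "generate H {h d} = h ` generate G {g \<otimes> c \<otimes> inv g}"
        using g cG dG by (simp only: img G.conj_set_generate flip: img)
      also have "\<dots> = generate H {h (g \<otimes> c \<otimes> inv g)}"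
        using g(1) cG by (intro img) simp
      also have "\<dots> = H.conj_set (h g) (generate H {h c})"
        using g(1) cG by (subst H.conj_set_generate) simp_all
      finally have "generate H {h d} = H.conj_set (h g) (generate H {h c})" .
      then show ?r unfolding iff(2) using g(1) by (intro bexI[of _ "h g"]) simp_all
    next
      assume ?r
      then obtain g where g: "g \<in> carrier G"
        and eq: "generate H {h d} = H.conj_set (h g) (generate H {h c})"
        unfolding iff(2) surj[symmetric] by blast
      (* The images of d and of the conjugate c' of c generate the same subgroup. *)
      define c' where "c' = g \<otimes> c \<otimes> inv g"
      have c': "c' \<in> carrier G" using g cG by (simp add: c'_def)
      have "generate H {h d} = generate H {h c'}"
        using eq g cG by (simp add: H.conj_set_generate c'_def)
      then have "h d \<in> h ` generate G {c'}"
        using img[OF c'] generate.incl[of "h d" "{h d}" H] by simp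
      then obtain e where e: "e \<in> generate G {c'}" "h d = h e" by blast
      have eG: "e \<in> carrier G" using e(1) sub[OF c'] by blast
      obtain k where k: "k \<in> carrier G" "e = k \<otimes> d \<otimes> inv k"
        using fibre[OF dG eG dmax e(2)] by blast
      have "maximal_cyclic_subgroup (generate G {e}) G"
        using max[OF eG] max[OF dG] dmax e(2) by simp
      moreover have "cyclic_subgroup (generate G {c'}) G"
        using c' by (auto simp: G.cyclic_subgroup_iff)
      ultimately have "generate G {e} = generate G {c'}"
        using G.generate_mono_mem[OF c' e(1)] by (auto simp: maximal_cyclic_subgroup_def)
      then have "G.conj_set k (generate G {d}) = G.conj_set g (generate G {c})"
        using k g cG dG by (simp add: G.conj_set_generate c'_def)
      then have "G.conj_set (inv k) (G.conj_set k (generate G {d}))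
          = G.conj_set (inv k \<otimes> g) (generate G {c})"
        using k(1) g sub[OF cG] by (simp only: G.conj_set_mult G.inv_closed)
      then have "generate G {d} = G.conj_set (inv k \<otimes> g) (generate G {c})"
        using k(1) sub[OF dG]
        by (simp only: G.conj_set_mult G.inv_closed G.l_inv G.conj_set_one)
      then show ?l unfolding iff(1) using k(1) g by (intro bexI[of _ "inv k \<otimes> g"]) simp_all
    qed
  qed
  then have "card ((\<lambda>c. orbit G G.conj_set (generate G {c})) ` G.max_cyclic_generators)
      = card ((\<lambda>c. orbit H H.conj_set (generate H {h c})) ` G.max_cyclic_generators)"
    by (rule card_image_eq_of_same_kernel)
  then show ?thesis
    by (simp add: G.eta_eq_card_image H.eta_eq_card_image gens image_image)
qed

text \<open>If \<open>c = d\<^sup>k\<close> with \<open>k\<close> prime to \<open>p\<close>, then \<open>c\<close> and \<open>d\<close> generate the same subgroup, so a strictly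
  larger cyclic group exhibits \<open>c\<close> as a \<open>p\<close>-th power. Conversely \<open>c = d\<^sup>p\<close> generates a strictly smaller
  group than \<open>d\<close> unless \<open>d = \<one>\<close>; this is where nontriviality enters, since \<open>\<one>\<close> is always a
  \<open>p\<close>-th power but generates a maximal cyclic subgroup of the trivial group.\<close>

lemma (in group) maximal_cyclic_iff_not_prime_power:
  fixes p :: nat
  assumes p: "Factorial_Ring.prime p"
    and tors: "\<And>g. g \<in> carrier G \<Longrightarrow> \<exists>n. g [^] (p ^ n) = \<one>"
    and nontriv: "\<exists>e\<in>carrier G. e \<noteq> \<one>"
    and c: "c \<in> carrier G"
  shows "maximal_cyclic_subgroup (generate G {c}) G \<longleftrightarrow> (\<forall>d\<in>carrier G. c \<noteq> d [^] p)"
proof -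
  have gen: "g \<in> generate G {g [^] k}" if g: "g \<in> carrier G" and k: "\<not> int p dvd k" for g and k :: int
  proof -
    obtain n where n: "g [^] (p ^ n) = \<one>" using tors[OF g] by blast
    have "coprime k (int (p ^ n))"
      using k p by (metis coprime_commute coprime_power_right_iff of_nat_power prime_imp_coprime prime_nat_int_transfer)
    then obtain l where "[k * l = 1] (mod int (p ^ n))" using cong_solve_coprime_int by blast
    then obtain a where "k * l = 1 + int (p ^ n) * a"
      by (metis cong_iff_lin cong_sym)
    then have "(g [^] k) [^] l = g [^] (1 :: int) \<otimes> (g [^] int (p ^ n)) [^] a"
      using g by (simp only: int_pow_pow int_pow_mult)
    also have "g [^] int (p ^ n) = \<one>" using n by (simp only: int_pow_int)
    finally have "g = (g [^] k) [^] l" using g by simp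
    then show ?thesis using mem_generate_iff[OF int_pow_closed[OF g]] by blast
  qed
  show ?thesis
  proof
    assume max: "maximal_cyclic_subgroup (generate G {c}) G"
    have up: "d \<in> generate G {c}" if d: "d \<in> carrier G" "c \<in> generate G {d}" for d
    proof -
      have "cyclic_subgroup (generate G {d}) G" using d by (auto simp: cyclic_subgroup_iff)
      then have "generate G {d} = generate G {c}"
        using max generate_mono_mem[OF d] by (auto simp: maximal_cyclic_subgroup_def)
      then show ?thesis by (metis generate.incl singletonI)
    qed
    show "\<forall>d\<in>carrier G. c \<noteq> d [^] p"
    proof (intro ballI notI)
      fix d assume d: "d \<in> carrier G" "c = d [^] p"
      then have cd: "c = d [^] int p" by (simp only: int_pow_int)
      then have "d \<in> generate G {c}"
        using up[OF d(1)] mem_generate_iff[OF d(1)] by blast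
      then obtain k :: int where "d = c [^] k" using mem_generate_iff[OF c] by blast
      then have "d = d [^] (int p * k)"
        using d(1) unfolding cd by (simp only: int_pow_pow)
      then have "d [^] (int p * k - 1) = \<one>"
        using d(1) by (simp add: int_pow_diff)
      moreover have "\<not> int p dvd int p * k - 1"
        using prime_gt_1_nat[OF p] by (simp add: dvd_diff_right_iff)
      ultimately have "d \<in> generate G {\<one>}" using gen[OF d(1)] by metis
      then have "d = \<one>" by (simp add: generate_one)
      then have "c = \<one>" using d by simp
      moreover obtain e where e: "e \<in> carrier G" "e \<noteq> \<one>" using nontriv by blast
      ultimately have "e \<in> generate G {\<one>}" using up[OF e(1)] by (simp add: generate.one)
      with e(2) show False by (simp add: generate_one)
    qed
  next
    assume npow: "\<forall>d\<in>carrier G. c \<noteq> d [^] p"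
    have "K = generate G {c}" if K: "cyclic_subgroup K G" "generate G {c} \<subseteq> K" for K
    proof -
      obtain d where d: "d \<in> carrier G" "K = generate G {d}"
        using K(1) cyclic_subgroup_iff by blast
      then have "c \<in> generate G {d}" using K(2) generate.incl[of c "{c}" G] by blast
      then obtain k :: int where k: "c = d [^] k" using mem_generate_iff[OF d(1)] by blast
      have "\<not> int p dvd k"
      proof
        assume "int p dvd k"
        then obtain l where "k = l * int p" by (metis dvd_def mult.commute)
        then have "c = (d [^] l) [^] int p" using k d(1) by (simp only: int_pow_pow)
        then have "c = (d [^] l) [^] p" by (simp only: int_pow_int)
        then show False using npow d by blast
      qed
      then have "d \<in> generate G {c}" using gen[OF d(1)] k by simp
      then show ?thesis using generate_mono_mem[OF c] d(2) K(2) by blast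
    qed
    then show "maximal_cyclic_subgroup (generate G {c}) G"
      using c by (auto simp: maximal_cyclic_subgroup_def cyclic_subgroup_iff)
  qed
qed

section \<open>Metacyclic groups with a positive action\<close>

text \<open>The relations of \<open>G\<^sub>p(\<alpha>, \<beta>, \<epsilon>, \<delta>, +)\<close> in the form in which they enter the argument. They bound the
  orders of \<open>x\<close> and \<open>y\<close> from above only, so an element may have several forms \<open>y\<^sup>j x\<^sup>i\<close>. The last assumption keeps
  \<open>G/G'\<close> nontrivial, as \<open>G'\<close> consists of powers of \<open>x\<close>.\<close>

locale metacyclic_positive = lifting_modulus p q + group G
  for p q :: nat and G :: "('a, 'm) monoid_scheme" (structure) +
  fixes x y :: 'a and \<alpha> \<beta> :: nat
  assumes x_closed [simp]: "x \<in> carrier G" and y_closed [simp]: "y \<in> carrier G"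
    and generated: "carrier G \<subseteq> generate G {x, y}"
    and x_order: "x [^] (p ^ \<alpha>) = \<one>"
    and y_order: "\<exists>e :: nat. y [^] (p ^ \<beta>) = x [^] e"
    and commute: "x \<otimes> y = y \<otimes> x [^] (1 + q)"
    and q_dvd: "q dvd p ^ \<alpha>"
    and y_not_power: "\<And>e :: nat. y \<noteq> x [^] e"
begin

definition yx :: "nat \<Rightarrow> nat \<Rightarrow> 'a" where
  "yx j i = y [^] j \<otimes> x [^] i"

lemma yx_closed [simp]: "yx j i \<in> carrier G"
  by (simp add: yx_def)

lemma x_pow_cong:
  assumes "[a = b] (mod p ^ \<alpha>)" shows "x [^] a = x [^] b"
proof -
  have "x [^] c = x [^] (c mod p ^ \<alpha>)" for c
  proof -
    have "x [^] c = (x [^] (p ^ \<alpha>)) [^] (c div p ^ \<alpha>) \<otimes> x [^] (c mod p ^ \<alpha>)"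
      by (simp only: nat_pow_pow nat_pow_mult x_closed mult_div_mod_eq)
    then show ?thesis by (simp add: x_order)
  qed
  then show ?thesis using assms by (metis cong_def)
qed

lemma yx_cong: "[a = b] (mod p ^ \<alpha>) \<Longrightarrow> yx j a = yx j b"
  by (simp only: yx_def x_pow_cong)

lemma x_pow_y: "x [^] i \<otimes> y = y \<otimes> x [^] (i * (1 + q))"
proof (induction i)
  case (Suc i)
  have "x [^] Suc i \<otimes> y = x [^] i \<otimes> (x \<otimes> y)" by (simp add: m_assoc)
  also have "\<dots> = (x [^] i \<otimes> y) \<otimes> x [^] (1 + q)" unfolding commute by (simp add: m_assoc del: nat_pow_Suc)
  also have "\<dots> = y \<otimes> (x [^] (i * (1 + q)) \<otimes> x [^] (1 + q))"
    unfolding Suc.IH by (rule m_assoc) simp_all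
  also have "\<dots> = y \<otimes> x [^] (Suc i * (1 + q))"
    by (simp only: nat_pow_mult x_closed mult_Suc add.commute)
  finally show ?case .
qed simp

lemma x_pow_y_pow: "x [^] i \<otimes> y [^] j = y [^] j \<otimes> x [^] (i * (1 + q) ^ j)"
proof (induction j)
  case (Suc j)
  have "x [^] i \<otimes> y [^] Suc j = (x [^] i \<otimes> y [^] j) \<otimes> y" by (simp add: m_assoc)
  also have "\<dots> = y [^] j \<otimes> (x [^] (i * (1 + q) ^ j) \<otimes> y)"
    unfolding Suc.IH by (rule m_assoc) simp_all
  also have "\<dots> = y [^] j \<otimes> (y \<otimes> x [^] (i * (1 + q) ^ j * (1 + q)))"
    unfolding x_pow_y ..
  also have "\<dots> = y [^] Suc j \<otimes> x [^] (i * (1 + q) ^ j * (1 + q))"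
    by (simp only: nat_pow_Suc) (rule m_assoc[symmetric], simp_all)
  also have "i * (1 + q) ^ j * (1 + q) = i * (1 + q) ^ Suc j" by (simp only: power_Suc mult_ac)
  finally show ?case .
qed simp

lemma yx_mult: "yx j i \<otimes> yx k l = yx (j + k) (i * (1 + q) ^ k + l)"
proof -
  have "yx j i \<otimes> yx k l = y [^] j \<otimes> (x [^] i \<otimes> y [^] k) \<otimes> x [^] l"
    by (simp add: yx_def m_assoc)
  also have "\<dots> = (y [^] j \<otimes> y [^] k) \<otimes> (x [^] (i * (1 + q) ^ k) \<otimes> x [^] l)"
    unfolding x_pow_y_pow by (simp add: m_assoc)
  finally show ?thesis by (simp only: yx_def nat_pow_mult x_closed y_closed)
qed

lemma yx_mult_x: "yx j i \<otimes> x [^] l = yx j (i + l)"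
  using yx_mult[of j i 0 l] by (simp add: yx_def)

lemma yx_pow: "yx j i [^] n = yx (j * n) (i * (\<Sum>k<n. ((1 + q) ^ j) ^ k))"
proof (induction n)
  case 0
  show ?case by (simp add: yx_def)
next
  case (Suc n)
  have "(\<Sum>k<Suc n. ((1 + q) ^ j) ^ k) = (\<Sum>k<n. ((1 + q) ^ j) ^ k) * (1 + q) ^ j + 1"
    unfolding sum.lessThan_Suc_shift by (simp add: sum_distrib_left mult_ac)
  then show ?case
    unfolding nat_pow_Suc Suc.IH yx_mult by (simp add: algebra_simps)
qed

lemma geometric_sum_power:
  obtains u where "(\<Sum>k<p. ((1 + q) ^ j) ^ k) = p * u" "\<not> p dvd u"
proof -
  obtain u where "(\<Sum>k<p. (1 + q * (\<Sum>k<j. (1 + q) ^ k)) ^ k) = p * u" "coprime u p"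
    by (rule geometric_sum)
  moreover from this(2) have "\<not> p dvd u"
    using prime_p by (metis coprime_absorb_right not_prime_unit)
  ultimately show thesis
    unfolding one_plus_power_eq[of q j, symmetric] by (intro that)
qed

text \<open>The \<open>p\<close>-th power of \<open>y\<^sup>j x\<^sup>w\<close> is \<open>y\<^sup>p\<^sup>j x\<^sup>p\<^sup>u\<^sup>w\<close> with a unit \<open>u\<close> that depends only on \<open>j\<close>, so \<open>w\<close> can be
  chosen to produce any prescribed \<open>p i\<close>.\<close>

lemma yx_mult_p_is_prime_power: "\<exists>d\<in>carrier G. yx (p * j) (p * i) = d [^] p"
proof -
  obtain u where u: "(\<Sum>k<p. ((1 + q) ^ j) ^ k) = p * u" "\<not> p dvd u"
    by (rule geometric_sum_power)
  obtain w where "[u * w = i] (mod p ^ \<alpha>)"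
    using prime_coprime_pow_solve[OF prime_p u(2)] .
  then have "[p * (u * w) = p * i] (mod p ^ \<alpha>)" by (rule cong_scalar_left)
  then have "yx (p * j) (p * i) = yx (p * j) (p * (u * w))" by (rule yx_cong[OF cong_sym])
  also have "\<dots> = yx j w [^] p" unfolding yx_pow u(1) by (simp only: mult_ac)
  finally show ?thesis by (intro bexI[of _ "yx j w"]) simp_all
qed

lemma yx_torsion: "yx j i [^] (p ^ (\<alpha> + \<beta>)) = \<one>"
proof -
  obtain e :: nat where e: "y [^] (p ^ \<beta>) = x [^] e" using y_order by blast
  define S where "S = i * (\<Sum>k<p ^ \<beta>. ((1 + q) ^ j) ^ k)"
  have "yx j i [^] (p ^ \<beta>) = (y [^] (p ^ \<beta>)) [^] j \<otimes> x [^] S"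
    unfolding yx_pow S_def[symmetric]
    by (simp only: yx_def nat_pow_pow y_closed mult.commute)
  also have "\<dots> = x [^] (e * j + S)"
    unfolding e by (simp only: nat_pow_pow nat_pow_mult x_closed)
  finally have pb: "yx j i [^] (p ^ \<beta>) = x [^] (e * j + S)" .
  have "yx j i [^] (p ^ (\<alpha> + \<beta>)) = (yx j i [^] (p ^ \<beta>)) [^] (p ^ \<alpha>)"
    by (simp only: nat_pow_pow yx_closed power_add mult.commute)
  also have "\<dots> = (x [^] (p ^ \<alpha>)) [^] (e * j + S)"
    unfolding pb by (simp only: nat_pow_pow x_closed mult.commute)
  finally show ?thesis by (simp add: x_order)
qed

lemma inv_yx: "\<exists>k l. inv (yx j i) = yx k l"
proof -
  have "p ^ (\<alpha> + \<beta>) = Suc (p ^ (\<alpha> + \<beta>) - 1)"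
    using prime_gt_0_nat[OF prime_p] by simp
  then have "yx j i [^] (p ^ (\<alpha> + \<beta>) - 1) \<otimes> yx j i = \<one>"
    using yx_torsion[of j i] by (metis nat_pow_Suc)
  then have "inv (yx j i) = yx j i [^] (p ^ (\<alpha> + \<beta>) - 1)"
    by (intro inv_equality) simp_all
  then show ?thesis unfolding yx_pow by blast
qed

lemma carrier_yx:
  assumes "g \<in> carrier G" obtains j i where "g = yx j i"
proof -
  have xy: "x = yx 0 1" "y = yx 1 0" by (simp_all add: yx_def)
  have "g \<in> generate G {x, y}" using assms generated by blast
  then have "\<exists>j i. g = yx j i"
  proof (induction rule: generate.induct)
    case one
    show ?case by (intro exI[of _ 0]) (simp add: yx_def)
  next
    case (incl h)
    then show ?case using xy by blast
  next
    case (inv h)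
    then show ?case using xy inv_yx by (metis insertE singletonD)
  next
    case (eng h1 h2)
    then show ?case using yx_mult by metis
  qed
  then show thesis using that by blast
qed

lemma prime_power_torsion: "g \<in> carrier G \<Longrightarrow> \<exists>n. g [^] (p ^ n) = \<one>"
  using carrier_yx yx_torsion by metis

text \<open>Since \<open>p\<close> divides \<open>q\<close>, the product still has both exponents divisible by \<open>p\<close>. This lets
  \<open>p\<close>-th powers of \<open>G/G'\<close> be lifted to \<open>G\<close>.\<close>

lemma prime_power_mult_x:
  assumes "d \<in> carrier G"
  shows "\<exists>d'\<in>carrier G. d [^] p \<otimes> x [^] (q * t) = d' [^] p"
proof -
  obtain j i where d: "d = yx j i" using assms by (rule carrier_yx)
  obtain u where u: "(\<Sum>k<p. ((1 + q) ^ j) ^ k) = p * u"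
    by (rule geometric_sum_power)
  obtain b where b: "q = p * b" using p_dvd_q by blast
  have "d [^] p \<otimes> x [^] (q * t) = yx (j * p) (i * (p * u) + q * t)"
    unfolding d yx_pow u yx_mult_x ..
  also have "\<dots> = yx (p * j) (p * (i * u + b * t))"
    unfolding b by (simp only: distrib_left mult_ac)
  finally show ?thesis using yx_mult_p_is_prime_power by simp
qed

text \<open>The coset of \<open>c\<close> modulo \<open>\<langle>x\<^sup>q\<rangle>\<close> lies in one conjugacy class: as \<open>c\<close> is not a
  \<open>p\<close>-th power, one of its two exponents is prime to \<open>p\<close>, and each case makes a different generator move \<open>c\<close> through the coset.\<close>

lemma conjugate_mult_x:
  assumes c: "c \<in> carrier G" and npow: "\<forall>d\<in>carrier G. c \<noteq> d [^] p"
  shows "\<exists>g\<in>carrier G. c \<otimes> x [^] (q * t) = g \<otimes> c \<otimes> inv g"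
proof -
  obtain j i where c_yx: "c = yx j i" using c by (rule carrier_yx)
  have "\<not> (p dvd j \<and> p dvd i)"
    using npow yx_mult_p_is_prime_power unfolding c_yx by (metis dvd_def)
  then consider (y) "\<not> p dvd j" | (x) "\<not> p dvd i" by blast
  then have "\<exists>g\<in>carrier G. c \<otimes> x [^] (q * t) \<otimes> g = g \<otimes> c"
  proof cases
    case y
    \<comment> \<open>Conjugation by \<open>x\<^sup>k\<close> adds \<open>k ((1 + q)\<^sup>j - 1) = k q v\<close> to the exponent of \<open>x\<close>, and \<open>v\<close> is \<open>j\<close> modulo \<open>p\<close>.\<close>
    define v where "v = (\<Sum>l<j. (1 + q) ^ l)"
    have "[v = (\<Sum>l<j. 1)] (mod p)"
      unfolding v_def
    proof (rule cong_sum)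
      fix l
      have "[1 + q = 1] (mod p)"
        using p_dvd_q by (simp only: cong_add_lcancel_0_nat cong_0_iff)
      from cong_pow[OF this, of l] show "[(1 + q) ^ l = 1] (mod p)" by simp
    qed
    then have "\<not> p dvd v" using y by (simp add: cong_dvd_iff)
    then obtain k where k: "[v * k = t] (mod p ^ \<alpha>)"
      using prime_coprime_pow_solve[OF prime_p] by blast
    have "x [^] k \<otimes> c = yx 0 k \<otimes> yx j i" by (simp add: yx_def c_yx)
    also have "\<dots> = yx j (k * (1 + q * v) + i)"
      unfolding yx_mult v_def one_plus_power_eq[of q j, symmetric] by simp
    also have "\<dots> = yx j (i + q * t + k)"
    proof (rule yx_cong)
      have "[i + q * (v * k) + k = i + q * t + k] (mod p ^ \<alpha>)"
        using k by (intro cong_add cong_scalar_left cong_refl)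
      then show "[k * (1 + q * v) + i = i + q * t + k] (mod p ^ \<alpha>)"
        by (simp add: algebra_simps)
    qed
    also have "\<dots> = c \<otimes> x [^] (q * t) \<otimes> x [^] k"
      unfolding c_yx yx_mult_x ..
    finally show ?thesis by (intro bexI[of _ "x [^] k"]) simp_all
  next
    case x
    \<comment> \<open>Conjugation by \<open>y\<^sup>l\<close> multiplies the exponent of \<open>x\<close> by \<open>(1 + q)\<^sup>l\<close>.\<close>
    obtain s where s: "[i * s = t] (mod p ^ \<alpha>)"
      using prime_coprime_pow_solve[OF prime_p x] by blast
    obtain l where "[(1 + q) ^ l = 1 + q * s] (mod q * p ^ \<alpha>)"
      by (rule power_surj_mod)
    then have "[(1 + q) ^ l = 1 + q * s] (mod p ^ \<alpha>)"
      by (rule cong_dvd_modulus_nat) simp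
    then have "[i * (1 + q) ^ l = i * (1 + q * s)] (mod p ^ \<alpha>)" by (rule cong_scalar_left)
    moreover have "[i + q * (i * s) = i + q * t] (mod p ^ \<alpha>)"
      using s by (intro cong_add cong_scalar_left cong_refl)
    moreover have "i * (1 + q * s) = i + q * (i * s)" by (simp add: algebra_simps)
    ultimately have il: "[i * (1 + q) ^ l = i + q * t] (mod p ^ \<alpha>)"
      by (metis cong_trans)
    have y_pow_yx: "y [^] l = yx l 0" by (simp add: yx_def)
    have "c \<otimes> y [^] l = yx (l + j) (i * (1 + q) ^ l)"
      unfolding c_yx y_pow_yx yx_mult by (simp add: add.commute)
    also have "\<dots> = yx (l + j) (i + q * t)" using il by (rule yx_cong)
    also have "\<dots> = y [^] l \<otimes> (c \<otimes> x [^] (q * t))"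
      unfolding c_yx y_pow_yx yx_mult_x yx_mult by simp
    finally have eq: "c \<otimes> y [^] l = y [^] l \<otimes> (c \<otimes> x [^] (q * t))" .
    show ?thesis
    proof (intro bexI)
      have "c \<otimes> x [^] (q * t) = inv (y [^] l) \<otimes> (c \<otimes> y [^] l)"
        unfolding eq using c by (simp flip: m_assoc)
      then show "c \<otimes> x [^] (q * t) \<otimes> inv (y [^] l) = inv (y [^] l) \<otimes> c"
        using c by (simp add: m_assoc)
    qed simp
  qed
  then obtain g where "g \<in> carrier G" "c \<otimes> x [^] (q * t) \<otimes> g = g \<otimes> c" by blast
  then show ?thesis using c by (intro bexI[of _ g]) (simp_all add: inv_solve_right)
qed

text \<open>Two products \<open>a b\<close> and \<open>b a\<close> have the same exponent of \<open>y\<close>, and their exponents of \<open>x\<close> agree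
  modulo \<open>q\<close>.\<close>

lemma derived_subset: "derived G (carrier G) \<subseteq> {x [^] (q * t) | t :: nat. True}"
proof -
  let ?Z = "{x [^] (q * t) | t :: nat. True}"
  have quotient: "\<exists>t. inv (x [^] b) \<otimes> x [^] a = x [^] (q * t)" if "[a = b] (mod q)" for a b :: nat
  proof -
    have "int q dvd int a - int b"
      using that by (simp add: cong_iff_dvd_diff flip: cong_int_iff)
    moreover have "int q dvd int b * int (p ^ \<alpha>)"
      using q_dvd by (simp only: int_dvd_int_iff dvd_mult)
    ultimately have "int q dvd (int a - int b) + int b * int (p ^ \<alpha>)"
      by (rule dvd_add)
    moreover have le: "b \<le> b * p ^ \<alpha>"
      using prime_gt_0_nat[OF prime_p] by simp
    then have "(int a - int b) + int b * int (p ^ \<alpha>) = int (a + (b * p ^ \<alpha> - b))"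
      by (simp only: of_nat_add of_nat_diff of_nat_mult)
    ultimately obtain t where t: "a + (b * p ^ \<alpha> - b) = q * t"
      by (metis dvd_def int_dvd_int_iff)
    \<comment> \<open>Adding the multiple \<open>b p\<^sup>\<alpha>\<close> of the order keeps the exponent \<open>a - b\<close> a natural number.\<close>
    have "x [^] b \<otimes> x [^] (q * t) = x [^] (b + q * t)" by (simp only: nat_pow_mult x_closed)
    also have "\<dots> = x [^] a"
    proof (rule x_pow_cong)
      have "b + q * t = a + b * p ^ \<alpha>" using t le by linarith
      then show "[b + q * t = a] (mod p ^ \<alpha>)" by (simp add: cong_def)
    qed
    finally have "x [^] (q * t) = inv (x [^] b) \<otimes> x [^] a"
      by (intro inv_solve_left[THEN iffD2]) simp_all
    then show ?thesis by metis
  qed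
  have "subgroup ?Z G"
  proof (rule subgroupI)
    fix a assume "a \<in> ?Z"
    then obtain t :: nat where a: "a = x [^] (q * t)" by blast
    show "inv a \<in> ?Z"
      using quotient[of 0 "q * t"] unfolding a by (auto simp: cong_def)
    fix b assume "b \<in> ?Z"
    then obtain s :: nat where "b = x [^] (q * s)" by blast
    then have "a \<otimes> b = x [^] (q * (t + s))"
      unfolding a by (simp only: nat_pow_mult x_closed distrib_left)
    then show "a \<otimes> b \<in> ?Z" by blast
  qed auto
  moreover have "derived_set G (carrier G) \<subseteq> ?Z"
  proof
    fix z assume "z \<in> derived_set G (carrier G)"
    then obtain a b where ab: "a \<in> carrier G" "b \<in> carrier G" "z = a \<otimes> b \<otimes> inv a \<otimes> inv b"
      by blast
    \<comment> \<open>Writing the commutator in terms of the inverses puts the two powers of \<open>y\<close> next to each other, where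
      they cancel.\<close>
    obtain j i where a: "inv a = yx j i" using carrier_yx[OF inv_closed[OF ab(1)]] .
    obtain k l where b: "inv b = yx k l" using carrier_yx[OF inv_closed[OF ab(2)]] .
    have "z = inv (inv b \<otimes> inv a) \<otimes> (inv a \<otimes> inv b)"
      using ab by (simp add: inv_mult_group m_assoc)
    also have "\<dots> = inv (yx (k + j) (l * (1 + q) ^ j + i)) \<otimes> yx (k + j) (i * (1 + q) ^ k + l)"
      unfolding a b yx_mult by (simp only: add.commute)
    also have "\<dots> = inv (x [^] (l * (1 + q) ^ j + i)) \<otimes> x [^] (i * (1 + q) ^ k + l)"
    proof -
      have "inv (w \<otimes> u) \<otimes> (w \<otimes> v) = inv u \<otimes> v"
        if "w \<in> carrier G" "u \<in> carrier G" "v \<in> carrier G" for u v w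
      proof -
        have "inv w \<otimes> (w \<otimes> v) = v" using that by (simp flip: m_assoc)
        then show ?thesis using that by (simp add: inv_mult_group m_assoc)
      qed
      then show ?thesis unfolding yx_def by simp
    qed
    finally have z: "z = inv (x [^] (l * (1 + q) ^ j + i)) \<otimes> x [^] (i * (1 + q) ^ k + l)" .
    have "[(1 + q) ^ n = 1] (mod q)" for n
      unfolding one_plus_power_eq[of q n] by (simp only: cong_add_lcancel_0_nat cong_mult_self_left)
    then have "[i * (1 + q) ^ k + l = i * 1 + l] (mod q)" "[l * (1 + q) ^ j + i = l * 1 + i] (mod q)"
      by (intro cong_add cong_scalar_left cong_refl; blast)+
    then have "[i * (1 + q) ^ k + l = l * (1 + q) ^ j + i] (mod q)"
      by (simp add: cong_def add.commute)
    from quotient[OF this] show "z \<in> ?Z" unfolding z by blast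
  qed
  ultimately show ?thesis
    unfolding derived_def by (rule generate_subgroup_incl[rotated])
qed

theorem eta_eq_eta_abelianization: "eta G = eta (G Mod derived G (carrier G))"
proof -
  let ?D = "derived G (carrier G)"
  let ?H = "G Mod ?D"
  let ?h = "\<lambda>a. ?D #> a"
  interpret D: normal ?D G by (rule derived_is_normal[OF normal_self])
  interpret h: group_hom G ?H ?h
    by (simp add: group_hom_def group_hom_axioms_def D.factorgroup_is_group D.r_coset_hom_Mod)
  have surj: "?h ` carrier G = carrier ?H"
    by (auto simp: FactGroup_def RCOSETS_def)
  have fibre: "\<exists>t. b = a \<otimes> x [^] (q * t)"
    if "a \<in> carrier G" "b \<in> carrier G" "?h a = ?h b" for a b
  proof -
    have "?h (inv a \<otimes> b) = inv\<^bsub>?H\<^esub> ?h b \<otimes>\<^bsub>?H\<^esub> ?h b"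
      using that by (simp only: h.hom_mult h.hom_inv inv_closed)
    also have "\<dots> = \<one>\<^bsub>?H\<^esub>" by (intro h.H.l_inv h.hom_closed that(2))
    finally have "?h (inv a \<otimes> b) = \<one>\<^bsub>?H\<^esub>" .
    then have "?D #> (inv a \<otimes> b) = ?D" by (simp only: FactGroup_def monoid.simps)
    then have "inv a \<otimes> b \<in> ?D"
      by (rule coset_join1) (intro m_closed inv_closed that(1,2) D.subgroup_axioms)+
    then obtain t :: nat where t: "inv a \<otimes> b = x [^] (q * t)" using derived_subset by blast
    have "b = a \<otimes> (inv a \<otimes> b)" using that(1,2) by (simp flip: m_assoc)
    then show ?thesis unfolding t by blast
  qed
  have pow: "(\<exists>d\<in>carrier G. c = d [^] p) \<longleftrightarrow> (\<exists>e\<in>carrier ?H. ?h c = e [^]\<^bsub>?H\<^esub> p)"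
    if c: "c \<in> carrier G" for c
  proof
    assume "\<exists>d\<in>carrier G. c = d [^] p"
    then obtain d where "d \<in> carrier G" "c = d [^] p" by blast
    then show "\<exists>e\<in>carrier ?H. ?h c = e [^]\<^bsub>?H\<^esub> p"
      by (intro bexI[of _ "?h d"]) (simp_all only: h.hom_nat_pow h.hom_closed)
  next
    assume "\<exists>e\<in>carrier ?H. ?h c = e [^]\<^bsub>?H\<^esub> p"
    then obtain d where d: "d \<in> carrier G" "?h c = ?h d [^]\<^bsub>?H\<^esub> p"
      unfolding surj[symmetric] by blast
    then have "?h (d [^] p) = ?h c" by (simp only: h.hom_nat_pow)
    then obtain t where "c = d [^] p \<otimes> x [^] (q * t)"
      using fibre[OF nat_pow_closed[OF d(1)] c] by blast
    then show "\<exists>d\<in>carrier G. c = d [^] p" using prime_power_mult_x[OF d(1)] by simp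
  qed
  have y_notin: "y \<notin> ?D" using derived_subset y_not_power by blast
  have maxG: "maximal_cyclic_subgroup (generate G {c}) G \<longleftrightarrow> (\<forall>d\<in>carrier G. c \<noteq> d [^] p)"
    if "c \<in> carrier G" for c
  proof (rule maximal_cyclic_iff_not_prime_power[OF prime_p prime_power_torsion _ that])
    show "\<exists>e\<in>carrier G. e \<noteq> \<one>" using y_not_power[of 0] by (intro bexI[of _ y]) simp_all
  qed
  have maxH: "maximal_cyclic_subgroup (generate ?H {c}) ?H \<longleftrightarrow> (\<forall>d\<in>carrier ?H. c \<noteq> d [^]\<^bsub>?H\<^esub> p)"
    if c: "c \<in> carrier ?H" for c
  proof (rule h.H.maximal_cyclic_iff_not_prime_power[OF prime_p _ _ c])
    fix g assume "g \<in> carrier ?H"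
    then obtain a where a: "a \<in> carrier G" "g = ?h a" unfolding surj[symmetric] by blast
    obtain n where "a [^] (p ^ n) = \<one>" using prime_power_torsion[OF a(1)] by blast
    then have "g [^]\<^bsub>?H\<^esub> (p ^ n) = \<one>\<^bsub>?H\<^esub>"
      unfolding a(2) using h.hom_nat_pow[OF a(1), of "p ^ n"] h.hom_one by simp
    then show "\<exists>n. g [^]\<^bsub>?H\<^esub> (p ^ n) = \<one>\<^bsub>?H\<^esub>" by blast
  next
    have "?h y \<noteq> \<one>\<^bsub>?H\<^esub>"
    proof
      assume "?h y = \<one>\<^bsub>?H\<^esub>"
      then have "?D #> y = ?D" by (simp only: FactGroup_def monoid.simps)
      then have "y \<in> ?D" by (rule coset_join1) (intro y_closed D.subgroup_axioms)+
      with y_notin show False by blast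
    qed
    then show "\<exists>e\<in>carrier ?H. e \<noteq> \<one>\<^bsub>?H\<^esub>" using h.hom_closed[OF y_closed] by blast
  qed
  show ?thesis
  proof (rule h.eta_eq_of_surj[OF surj])
    fix c assume c: "c \<in> carrier G"
    show "maximal_cyclic_subgroup (generate G {c}) G
        \<longleftrightarrow> maximal_cyclic_subgroup (generate ?H {?h c}) ?H"
      unfolding maxG[OF c] maxH[OF h.hom_closed[OF c]] using pow[OF c] by blast
  next
    fix c d assume cd: "c \<in> carrier G" "d \<in> carrier G" "?h c = ?h d"
      and max: "maximal_cyclic_subgroup (generate G {c}) G"
    obtain t where "d = c \<otimes> x [^] (q * t)" using fibre[OF cd] by blast
    then show "\<exists>g\<in>carrier G. d = g \<otimes> c \<otimes> inv g"
      using conjugate_mult_x[OF cd(1)] maxG[OF cd(1)] max by blast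
  qed
qed

end

section \<open>The presented group\<close>

lemma word_class_replicate:
  "word_class R (replicate n (g, True)) = word_class R [(g, True)] [^]\<^bsub>presented_group R\<^esub> n"
proof (induction n)
  case (Suc n)
  have "word_class R (replicate (Suc n) (g, True)) = word_class R (replicate n (g, True) @ [(g, True)])"
    by (simp add: replicate_append_same)
  then show ?case
    unfolding mult_presented_group[symmetric] Suc.IH by simp
qed (simp add: one_presented_group)

lemma presented_group_generated:
  "carrier (presented_group R) = generate (presented_group R) (range (\<lambda>g. word_class R [(g, True)]))"
  (is "_ = generate ?P ?S")
proof -
  interpret group ?P by (rule group_presented_group)
  have S: "?S \<subseteq> carrier ?P" by (auto simp: carrier_presented_group)
  have "word_class R w \<in> generate ?P ?S" for w
  proof (induction w)
    case Nil
    show ?case unfolding one_presented_group[symmetric] by (rule generate.one)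
  next
    case (Cons a w)
    obtain g b where a: "a = (g, b)" by force
    have "word_class R [(g, False)] = inv\<^bsub>?P\<^esub> word_class R [(g, True)]"
    proof (rule inv_equality[symmetric])
      show "word_class R [(g, False)] \<otimes>\<^bsub>?P\<^esub> word_class R [(g, True)] = \<one>\<^bsub>?P\<^esub>"
        using pres_eq.cancel[of R g False]
        by (simp add: mult_presented_group one_presented_group word_class_eq_iff)
    qed (simp_all add: carrier_presented_group)
    then have "word_class R [a] \<in> generate ?P ?S"
      unfolding a by (cases b) (auto intro: generate.incl generate.inv)
    then have "word_class R [a] \<otimes>\<^bsub>?P\<^esub> word_class R w \<in> generate ?P ?S"
      using Cons.IH by (rule generate.eng)
    then show ?case by (simp add: mult_presented_group)
  qed
  then show ?thesis using generate_incl[OF S] by (auto simp: carrier_presented_group)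
qed

lemma (in group) word_eval_replicate:
  assumes "f g \<in> carrier G"
  shows "word_eval G f (replicate n (g, True)) = f g [^] n"
proof (induction n)
  case (Suc n)
  then show ?case unfolding nat_pow_Suc2[OF assms] by simp
qed simp

theorem theorem1p2:
  fixes p \<alpha> \<beta> \<epsilon> \<delta> :: nat
  assumes "Factorial_Ring.prime p"
    and "\<alpha> > 0" and "\<beta> > 0"
    and "\<delta> \<le> min (\<alpha> - 1) \<beta>"
    and "\<delta> + \<epsilon> \<le> \<alpha>"
    and "p = 2 \<Longrightarrow> \<alpha> - \<delta> > 1"
    and "G = metacyclic_pos p \<alpha> \<beta> \<epsilon> \<delta>"
  shows "eta G = eta (G Mod derived G (carrier G))"
proof -
  define q where "q = p ^ (\<alpha> - \<delta>)"
  define R where "R = {(replicate (p ^ \<alpha>) (Gx, True), []),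
     (replicate (p ^ \<beta>) (Gy, True), replicate (p ^ (\<alpha> - \<epsilon>)) (Gx, True)),
     ([(Gy, False), (Gx, True), (Gy, True)], replicate (q + 1) (Gx, True))}"
  have G: "G = presented_group R"
    using assms(7) by (simp only: metacyclic_pos_def R_def q_def)
  let ?w = "word_class R"
  let ?x = "?w [(Gx, True)]" and ?y = "?w [(Gy, True)]"
  interpret group G unfolding G by (rule group_presented_group)
  have p1: "p > 1" using assms(1) by (rule prime_gt_1_nat)
  have closed: "?w w \<in> carrier G" for w by (simp add: G carrier_presented_group)
  have mult: "?w u \<otimes>\<^bsub>G\<^esub> ?w v = ?w (u @ v)" for u v by (simp only: G mult_presented_group)
  have rel: "?w u = ?w v" if "(u, v) \<in> R" for u v
    using that by (simp add: word_class_eq_iff pres_eq.rel)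
  have pow: "?w (replicate n (g, True)) = ?w [(g, True)] [^]\<^bsub>G\<^esub> n" for n g
    unfolding G by (rule word_class_replicate)
  interpret metacyclic_positive p q G ?x ?y \<alpha> \<beta>
  proof
    show "Factorial_Ring.prime p" by fact
    show "p dvd q" unfolding q_def using assms(2,4) by (intro dvd_power) auto
    show "4 dvd q" if "p = 2"
    proof -
      have "2 ^ 2 dvd (2 :: nat) ^ (\<alpha> - \<delta>)" using assms(6)[OF that] by (intro le_imp_power_dvd) simp
      then show ?thesis by (simp add: q_def that)
    qed
    show "q dvd p ^ \<alpha>" unfolding q_def by (intro le_imp_power_dvd) simp
    show "?x \<in> carrier G" "?y \<in> carrier G" by (rule closed)+
    have "range (\<lambda>g. ?w [(g, True)]) = {?x, ?y}"
      by (auto simp: image_iff) (metis xy.exhaust)+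
    then show "carrier G \<subseteq> generate G {?x, ?y}"
      using presented_group_generated[of R] by (simp add: G)
    have "?w (replicate (p ^ \<alpha>) (Gx, True)) = ?w []" by (rule rel) (simp add: R_def)
    then show "?x [^]\<^bsub>G\<^esub> (p ^ \<alpha>) = \<one>\<^bsub>G\<^esub>"
      unfolding pow by (simp only: G one_presented_group)
    have "?w (replicate (p ^ \<beta>) (Gy, True)) = ?w (replicate (p ^ (\<alpha> - \<epsilon>)) (Gx, True))"
      by (rule rel) (simp add: R_def)
    then show "\<exists>e :: nat. ?y [^]\<^bsub>G\<^esub> (p ^ \<beta>) = ?x [^]\<^bsub>G\<^esub> e" unfolding pow by blast
    have "?w [(Gy, False), (Gx, True), (Gy, True)] = ?w (replicate (q + 1) (Gx, True))"
      by (rule rel) (simp add: R_def)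
    then have "?y \<otimes>\<^bsub>G\<^esub> ?x [^]\<^bsub>G\<^esub> (1 + q) = ?y \<otimes>\<^bsub>G\<^esub> ?w [(Gy, False), (Gx, True), (Gy, True)]"
      by (simp only: pow add.commute)
    also have "\<dots> = ?w ([(Gy, True), (Gy, \<not> True)] @ [(Gx, True), (Gy, True)])"
      by (simp add: mult)
    also have "\<dots> = ?w ([] @ [(Gx, True), (Gy, True)])"
      unfolding word_class_eq_iff by (intro pres_eq.append pres_eq.cancel pres_eq.refl)
    also have "\<dots> = ?x \<otimes>\<^bsub>G\<^esub> ?y" by (simp add: mult)
    finally show "?x \<otimes>\<^bsub>G\<^esub> ?y = ?y \<otimes>\<^bsub>G\<^esub> ?x [^]\<^bsub>G\<^esub> (1 + q)" ..
    show "?y \<noteq> ?x [^]\<^bsub>G\<^esub> e" for e :: nat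
    proof
      \<comment> \<open>Sending \<open>x\<close> to \<open>0\<close> and \<open>y\<close> to \<open>1\<close> respects the relations because \<open>\<beta> > 0\<close>, and separates \<open>y\<close> from
        the powers of \<open>x\<close>.\<close>
      let ?Z = "integer_mod_group p" and ?f = "case_xy 0 1 :: xy \<Rightarrow> int"
      interpret Z: group ?Z by simp
      have f: "range ?f \<subseteq> carrier ?Z"
        using p1 by (auto split: xy.split)
      have f': "?f g \<in> carrier ?Z" for g using f by blast
      have R: "word_eval ?Z ?f u = word_eval ?Z ?f v" if "(u, v) \<in> R" for u v
        using that p1 assms(3) f' unfolding R_def
        by (auto simp: Z.word_eval_replicate mod_add_left_eq simp del: replicate_Suc)
      obtain h where h: "h \<in> hom (presented_group R) ?Z" "\<And>w. h (?w w) = word_eval ?Z ?f w"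
        using Z.presented_group_universal[OF f R] by blast
      assume "?y = ?x [^]\<^bsub>G\<^esub> e"
      then have "h (?w [(Gy, True)]) = h (?w (replicate e (Gx, True)))"
        by (simp only: pow)
      then show False
        unfolding h(2) using p1 f' by (simp add: Z.word_eval_replicate)
    qed
  qed
  show ?thesis by (rule eta_eq_eta_abelianization)
qed

end
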